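(* If $\mathcal{H}$ is a hypergraph on $n$ vertices which contains neither isolated vertices nor edges of size smaller than $3$, then $\gamma_g(\mathcal{H})\le \frac{5}{9}n$.
   Context: Hypergraphs are finite. Two distinct vertices are adjacent if some edge contains both; $N[v]$ is $v$ together with all vertices adjacent to $v$, and $N[S]=\bigcup_{v\in S}N[v]$. The domination game: Dominator and Staller alternately choose vertices $v_1,v_2,\dots$; with $D_i=\{v_1,\dots,v_i\}$, each chosen vertex must satisfy $N[v_i]\setminus N[D_{i-1}]\ne\emptyset$, and the game ends when $N[D_d]=V(\mathcal{H})$. Dominator aims to minimize the number of moves, Staller to maximize it. $\gamma_g(\mathcal{H})$ is the number of moves under optimal play when Dominator moves first. *)

theory Defs
  imports Complex_Main
begin

definition hypergraph :: "'a set \<Rightarrow> 'a set set \<Rightarrow> bool" where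
  "hypergraph V E \<longleftrightarrow> finite V \<and> (\<forall>e\<in>E. e \<subseteq> V)"

definition adjacent :: "'a set set \<Rightarrow> 'a \<Rightarrow> 'a \<Rightarrow> bool" where
  "adjacent E u v \<longleftrightarrow> u \<noteq> v \<and> (\<exists>e\<in>E. u \<in> e \<and> v \<in> e)"

definition closed_nbhd :: "'a set set \<Rightarrow> 'a \<Rightarrow> 'a set" where
  "closed_nbhd E v = insert v {u. adjacent E v u}"

definition closed_nbhd_set :: "'a set set \<Rightarrow> 'a set \<Rightarrow> 'a set" where
  "closed_nbhd_set E S = (\<Union>v\<in>S. closed_nbhd E v)"

definition isolated :: "'a set set \<Rightarrow> 'a \<Rightarrow> bool" where
  "isolated E v \<longleftrightarrow> (\<forall>u. \<not> adjacent E v u)"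

definition legal_moves :: "'a set \<Rightarrow> 'a set set \<Rightarrow> 'a set \<Rightarrow> 'a set" where
  "legal_moves V E D = {v \<in> V. closed_nbhd E v - closed_nbhd_set E D \<noteq> {}}"

text \<open>Value of the game (number of remaining moves under optimal play) from the
position where the vertices D have been chosen; the boolean is True iff it is
Dominator's turn. The fuel argument bounds recursion depth; since every legal
move dominates a new vertex, fuel = card V suffices for play from the empty position.\<close>
fun game_val :: "nat \<Rightarrow> 'a set \<Rightarrow> 'a set set \<Rightarrow> bool \<Rightarrow> 'a set \<Rightarrow> nat" where
  "game_val 0 V E dtn D = 0"
| "game_val (Suc f) V E dtn D =
     (if closed_nbhd_set E D = V then 0
      else if dtn then Suc (Min ((\<lambda>v. game_val f V E False (insert v D)) ` legal_moves V E D))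
      else Suc (Max ((\<lambda>v. game_val f V E True (insert v D)) ` legal_moves V E D)))"

definition game_domination_number :: "'a set \<Rightarrow> 'a set set \<Rightarrow> nat" where
  "game_domination_number V E = game_val (card V) V E True {}"

end

theory Submission
  imports Defs
begin

text \<open>
A position is the set \<open>W\<close> of undominated (white) vertices. A white vertex weighs 30, and a dominated
vertex weighs at most 14, depending on the number of white vertices it still sees; vertices seeing no
white vertex weigh 0. Dominator plays so that each of his moves together with Staller's reply
decreases the total weight by at least 108, so a move costs 54 on average and at most \<open>30 n / 54\<close>
moves are made. The weights are lowered as the structure becomes simpler: with weight 14 for all
dominated vertices, Dominator gains 78 while some closed neighbourhood has four white vertices (Staller
always loses 30). Afterwards dominated vertices seeing one white vertex weigh 12, and Dominator
gains 80 (against 28) from a white triangle or the end of a white path. The white vertices with two white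
neighbours then form cycles of length at least 4; their vertices, once dominated, weigh only 8 or 12, which
makes breaking a cycle worth 78. When only isolated white vertices and white pairs are left, every
edge still lies in a triangle, so each white vertex has enough dominated neighbours to pay for
the remaining moves.
\<close>

section \<open>Potential bounds for the game\<close>

text \<open>
No lower bound on the fuel \<open>f\<close> is needed: running out of fuel only makes the value smaller.
\<close>
definition moves_bounded :: "'a set \<Rightarrow> 'a set set \<Rightarrow> 'a set \<Rightarrow> int \<Rightarrow> bool" where
  "moves_bounded V E W m \<longleftrightarrow>
     (\<forall>f D. D \<subseteq> V \<longrightarrow> V - closed_nbhd_set E D = W \<longrightarrow> 54 * int (game_val f V E True D) \<le> m)"

lemma moves_bounded_mono: "moves_bounded V E W m \<Longrightarrow> m \<le> m' \<Longrightarrow> moves_bounded V E W m'"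
  unfolding moves_bounded_def by (blast intro: order_trans)

lemma closed_nbhd_set_insert:
  "closed_nbhd_set E (insert v D) = closed_nbhd E v \<union> closed_nbhd_set E D"
  by (simp add: closed_nbhd_set_def)

lemma closed_nbhd_subset:
  assumes "hypergraph V E" "v \<in> V"
  shows "closed_nbhd E v \<subseteq> V"
  using assms by (auto simp: closed_nbhd_def adjacent_def hypergraph_def)

lemma closed_nbhd_set_subset:
  assumes "hypergraph V E" "D \<subseteq> V"
  shows "closed_nbhd_set E D \<subseteq> V"
  using closed_nbhd_subset[OF assms(1)] assms(2) by (fastforce simp: closed_nbhd_set_def)

lemma legal_moves_eq:
  assumes "hypergraph V E"
  shows "legal_moves V E D = {v \<in> V. closed_nbhd E v \<inter> (V - closed_nbhd_set E D) \<noteq> {}}"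
  using closed_nbhd_subset[OF assms] by (fastforce simp: legal_moves_def)

text \<open>Telescoping over rounds of two moves: a drop of 108 pays 54 for Dominator's move and 54
  for Staller's reply, and the separate drop of 54 covers a game that stops after Dominator's move.
  The first alternative hands the position over to a bound obtained with other weights.
  \<open>P\<close> records the structure reached so far; it has to be hereditary because white sets
  only shrink.\<close>

lemma moves_bounded_strategy:
  fixes \<Phi> :: "'a set \<Rightarrow> int"
  assumes hyp: "hypergraph V E"
    and nonneg: "\<And>W. 0 \<le> \<Phi> W"
    and P_mono: "\<And>W W'. P W \<Longrightarrow> W' \<subseteq> W \<Longrightarrow> P W'"
    and strat: "\<And>W. W \<subseteq> V \<Longrightarrow> W \<noteq> {} \<Longrightarrow> P W \<Longrightarrow> moves_bounded V E W (\<Phi> W) \<or>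
       (\<exists>v\<in>V. closed_nbhd E v \<inter> W \<noteq> {} \<and> 54 \<le> \<Phi> W - \<Phi> (W - closed_nbhd E v) \<and>
         (\<forall>p\<in>V. closed_nbhd E p \<inter> (W - closed_nbhd E v) \<noteq> {} \<longrightarrow>
            108 \<le> \<Phi> W - \<Phi> (W - closed_nbhd E v - closed_nbhd E p)))"
    and "P W"
  shows "moves_bounded V E W (\<Phi> W)"
proof -
  have fin: "finite V" using hyp by (simp add: hypergraph_def)
  \<comment> \<open>Strong induction on the fuel, because one round uses two units of it.\<close>
  have "54 * int (game_val f V E True D) \<le> \<Phi> (V - closed_nbhd_set E D)"
    if "D \<subseteq> V" "P (V - closed_nbhd_set E D)" for f D
    using that
  proof (induction f arbitrary: D rule: less_induct)
    case (less f)
    define U where "U = V - closed_nbhd_set E D"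
    show ?case
    proof (cases "f = 0 \<or> U = {}")
      case True
      then show ?thesis
      proof
        assume "f = 0" then show ?thesis using nonneg by simp
      next
        assume "U = {}"
        then have "closed_nbhd_set E D = V"
          using closed_nbhd_set_subset[OF hyp less.prems(1)] U_def by blast
        then show ?thesis using nonneg by (cases f) auto
      qed
    next
      case False
      then obtain k where f: "f = Suc k" by (cases f) auto
      from False have U: "U \<noteq> {}" by simp
      have nf: "closed_nbhd_set E D \<noteq> V" using U U_def by auto
      have "moves_bounded V E U (\<Phi> U) \<or>
       (\<exists>v\<in>V. closed_nbhd E v \<inter> U \<noteq> {} \<and> 54 \<le> \<Phi> U - \<Phi> (U - closed_nbhd E v) \<and>
         (\<forall>p\<in>V. closed_nbhd E p \<inter> (U - closed_nbhd E v) \<noteq> {} \<longrightarrow>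
            108 \<le> \<Phi> U - \<Phi> (U - closed_nbhd E v - closed_nbhd E p)))"
        using strat[of U] U less.prems(2) by (auto simp: U_def)
      then show ?thesis
      proof
        assume "moves_bounded V E U (\<Phi> U)"
        then show ?thesis using less.prems(1) by (auto simp: moves_bounded_def U_def)
      next
        assume "\<exists>v\<in>V. closed_nbhd E v \<inter> U \<noteq> {} \<and> 54 \<le> \<Phi> U - \<Phi> (U - closed_nbhd E v) \<and>
         (\<forall>p\<in>V. closed_nbhd E p \<inter> (U - closed_nbhd E v) \<noteq> {} \<longrightarrow>
            108 \<le> \<Phi> U - \<Phi> (U - closed_nbhd E v - closed_nbhd E p))"
        then obtain v where v: "v \<in> V" "closed_nbhd E v \<inter> U \<noteq> {}"
          and v54: "54 \<le> \<Phi> U - \<Phi> (U - closed_nbhd E v)"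
          and v108: "\<And>p. p \<in> V \<Longrightarrow> closed_nbhd E p \<inter> (U - closed_nbhd E v) \<noteq> {} \<Longrightarrow>
            108 \<le> \<Phi> U - \<Phi> (U - closed_nbhd E v - closed_nbhd E p)"
          by blast
        define D1 where "D1 = insert v D"
        have D1: "D1 \<subseteq> V" using v less.prems(1) by (simp add: D1_def)
        have U1: "V - closed_nbhd_set E D1 = U - closed_nbhd E v"
          by (auto simp: D1_def closed_nbhd_set_insert U_def)
        have "v \<in> legal_moves V E D" using v by (simp add: legal_moves_eq[OF hyp] U_def)
        moreover have "finite (legal_moves V E D)" using fin by (simp add: legal_moves_def)
        ultimately have "Min ((\<lambda>v. game_val k V E False (insert v D)) ` legal_moves V E D)
            \<le> game_val k V E False D1"
          unfolding D1_def by (intro Min_le) auto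
        then have val: "game_val f V E True D \<le> Suc (game_val k V E False D1)"
          using f nf by simp
        show ?thesis
        proof (cases "k = 0 \<or> U - closed_nbhd E v = {}")
          \<comment> \<open>Only Dominator's move is counted here, so the drop of 54 and the
            nonnegativity of \<open>\<Phi>\<close> suffice.\<close>
          case True
          then have "game_val k V E False D1 = 0"
            using U1 closed_nbhd_set_subset[OF hyp D1] by (cases k) auto
          then show ?thesis using val v54 nonneg[of "U - closed_nbhd E v"] by (simp add: U_def)
        next
          case False
          then obtain j where k: "k = Suc j" by (cases k) auto
          have nf1: "closed_nbhd_set E D1 \<noteq> V" using False U1 by auto
          have "\<exists>x. x \<in> U - closed_nbhd E v" using False by blast
          then obtain x where x: "x \<in> U - closed_nbhd E v" by blast
          \<comment> \<open>An undominated vertex is itself a legal move, so the \<open>Max\<close>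
            below ranges over a nonempty set.\<close>
          have "x \<in> legal_moves V E D1"
            using x unfolding legal_moves_eq[OF hyp] U1 by (auto simp: closed_nbhd_def U_def)
          then have ne: "legal_moves V E D1 \<noteq> {}" by blast
          have "finite (legal_moves V E D1)" using fin by (simp add: legal_moves_def)
          then have "Max ((\<lambda>v. game_val j V E True (insert v D1)) ` legal_moves V E D1)
             \<in> (\<lambda>v. game_val j V E True (insert v D1)) ` legal_moves V E D1"
            using ne by (intro Max_in) auto
          then obtain p where p: "p \<in> legal_moves V E D1"
            and pmax: "game_val k V E False D1 = Suc (game_val j V E True (insert p D1))"
            using k nf1 by auto
          have pV: "p \<in> V" and pN: "closed_nbhd E p \<inter> (U - closed_nbhd E v) \<noteq> {}"
            using p unfolding legal_moves_eq[OF hyp] U1 by auto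
          have U2: "V - closed_nbhd_set E (insert p D1) = U - closed_nbhd E v - closed_nbhd E p"
            using U1 by (auto simp: closed_nbhd_set_insert)
          have "54 * int (game_val j V E True (insert p D1))
              \<le> \<Phi> (U - closed_nbhd E v - closed_nbhd E p)"
            using less.IH[of j "insert p D1"] f k D1 pV
              P_mono[OF less.prems(2), of "V - closed_nbhd_set E (insert p D1)"]
            unfolding U2 by (auto simp: U_def)
          then show ?thesis using val pmax v108[OF pV pN] by (simp add: U_def)
        qed
      qed
    qed
  qed
  then show ?thesis using \<open>P W\<close> by (auto simp: moves_bounded_def)
qed

section \<open>Weights\<close>

text \<open>Abstract form of the hypergraph in terms of closed neighbourhoods \<open>N\<close>:
  edges of size at least 3 put every adjacent pair into a triangle, and these triangles supply the
  dominated vertices counted below.\<close>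

locale triangle_graph =
  fixes V :: "'a set" and N :: "'a \<Rightarrow> 'a set"
  assumes finite_V: "finite V"
    and N_subset: "v \<in> V \<Longrightarrow> N v \<subseteq> V"
    and N_self: "v \<in> N v"
    and N_sym: "u \<in> N v \<Longrightarrow> v \<in> N u"
    and triangle: "u \<in> N v \<Longrightarrow> u \<noteq> v \<Longrightarrow> \<exists>w. w \<in> N u \<and> w \<in> N v \<and> w \<noteq> u \<and> w \<noteq> v"
    and not_isolated: "v \<in> V \<Longrightarrow> \<exists>u\<in>N v. u \<noteq> v"
begin

definition weight :: "('a \<Rightarrow> nat \<Rightarrow> int) \<Rightarrow> 'a set \<Rightarrow> 'a \<Rightarrow> int" where
  "weight g W v = (if v \<in> W then 30 else g v (card (N v \<inter> W)))"

definition potential :: "('a \<Rightarrow> nat \<Rightarrow> int) \<Rightarrow> 'a set \<Rightarrow> int" where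
  "potential g W = (\<Sum>v\<in>V. weight g W v)"

definition loss :: "('a \<Rightarrow> nat \<Rightarrow> int) \<Rightarrow> 'a set \<Rightarrow> 'a \<Rightarrow> 'a \<Rightarrow> int" where
  "loss g W p v = weight g W v - weight g (W - N p) v"

definition gain :: "('a \<Rightarrow> nat \<Rightarrow> int) \<Rightarrow> 'a set \<Rightarrow> 'a \<Rightarrow> int" where
  "gain g W p = potential g W - potential g (W - N p)"

text \<open>The cap of 14 below the white weight 30 and the monotonicity in the number of white
  neighbours ensure that no vertex becomes heavier when \<open>W\<close> shrinks.\<close>

definition admissible :: "('a \<Rightarrow> nat \<Rightarrow> int) \<Rightarrow> bool" where
  "admissible g \<longleftrightarrow> (\<forall>v. g v 0 = 0 \<and> (\<forall>k. g v k \<le> 14) \<and> (\<forall>j k. j \<le> k \<longrightarrow> g v j \<le> g v k))"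

section \<open>General estimates for weights, losses and gains\<close>

lemma finite_Int_N: "W \<subseteq> V \<Longrightarrow> finite (N v \<inter> W)"
  using finite_V finite_subset by blast

lemma admissible_bounds:
  assumes "admissible g"
  shows "0 \<le> g v k" "g v k \<le> 14" "j \<le> k \<Longrightarrow> g v j \<le> g v k"
proof -
  have "g v 0 \<le> g v k" "g v 0 = 0" using assms unfolding admissible_def by blast+
  then show "0 \<le> g v k" by simp
qed (use assms in \<open>auto simp: admissible_def\<close>)

lemma potential_nonneg: "admissible g \<Longrightarrow> 0 \<le> potential g W"
  unfolding potential_def weight_def by (intro sum_nonneg) (auto simp: admissible_bounds)

lemma potential_mono:
  assumes "\<And>v k. g v k \<le> h v k"
  shows "potential g W \<le> potential h W"
  unfolding potential_def weight_def by (intro sum_mono) (auto simp: assms)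

lemma loss_nonneg:
  assumes "admissible g" "W \<subseteq> V"
  shows "0 \<le> loss g W p v"
proof -
  have "card (N v \<inter> (W - N p)) \<le> card (N v \<inter> W)"
    using finite_Int_N[OF assms(2)] by (intro card_mono) auto
  then have "g v (card (N v \<inter> (W - N p))) \<le> g v (card (N v \<inter> W))"
    using admissible_bounds[OF assms(1)] by blast
  moreover have "g v k \<le> 30" for k using admissible_bounds(2)[OF assms(1), of v k] by linarith
  ultimately show ?thesis by (auto simp: loss_def weight_def)
qed

text \<open>No vertex has negative loss, so any partial list bounds the gain from below. White and
  dominated vertices are listed separately, which makes the lists disjoint, and explicit lists leave
  concrete sums for the simplifier.\<close>

lemma gain_ge:
  assumes "admissible g" "W \<subseteq> V" "distinct xs" "set xs \<subseteq> W" "distinct ys" "set ys \<subseteq> V - W"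
  shows "(\<Sum>v\<leftarrow>xs. loss g W p v) + (\<Sum>v\<leftarrow>ys. loss g W p v) \<le> gain g W p"
proof -
  have "set xs \<inter> set ys = {}" using assms by blast
  then have "distinct (xs @ ys)" using assms by simp
  then have "(\<Sum>v\<leftarrow>xs @ ys. loss g W p v) = (\<Sum>v\<in>set (xs @ ys). loss g W p v)"
    by (rule sum.distinct_set_conv_list[symmetric])
  also have "\<dots> \<le> (\<Sum>v\<in>V. loss g W p v)"
    using assms loss_nonneg finite_V by (intro sum_mono2) auto
  also have "\<dots> = gain g W p"
    by (simp add: gain_def potential_def loss_def sum_subtractf)
  finally show ?thesis by simp
qed

lemma gain_legal:
  assumes "0 < gain g W p"
  shows "N p \<inter> W \<noteq> {}"
proof
  assume "N p \<inter> W = {}"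
  then have "W - N p = W" by blast
  then show False using assms by (simp add: gain_def)
qed

text \<open>A uniform bound \<open>b\<close> on Staller's replies completes a round. Legality of
  Dominator's move comes from its positive gain, since a move that dominates nothing new has gain
  0.\<close>

lemma round_of_gain:
  assumes "x \<in> V" "54 \<le> a" "a \<le> gain g W x" "108 \<le> a + b"
    and "\<And>p. p \<in> V \<Longrightarrow> N p \<inter> (W - N x) \<noteq> {} \<Longrightarrow> b \<le> gain g (W - N x) p"
  shows "\<exists>v\<in>V. N v \<inter> W \<noteq> {} \<and> 54 \<le> gain g W v \<and>
    (\<forall>p\<in>V. N p \<inter> (W - N v) \<noteq> {} \<longrightarrow> 108 \<le> gain g W v + gain g (W - N v) p)"
proof (intro bexI conjI ballI impI)
  show "N x \<inter> W \<noteq> {}" using gain_legal[of g W x] assms(2,3) by linarith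
  show "108 \<le> gain g W x + gain g (W - N x) p" if "p \<in> V" "N p \<inter> (W - N x) \<noteq> {}" for p
    using assms(5)[OF that] assms(3,4) by linarith
qed (use assms in auto)

lemma loss_white:
  "v \<in> W \<Longrightarrow> v \<in> N p \<Longrightarrow> loss g W p v = 30 - g v (card (N v \<inter> W - N p))"
  by (simp add: loss_def weight_def Int_Diff)

lemma loss_white_all:
  assumes "admissible g" "v \<in> W" "v \<in> N p" "N v \<inter> W \<subseteq> N p"
  shows "loss g W p v = 30"
proof -
  have "card (N v \<inter> W - N p) = 0" using assms(4) by (metis Diff_eq_empty_iff card.empty)
  then have "loss g W p v = 30 - g v 0" using loss_white[OF assms(2,3), of g] by simp
  then show ?thesis using assms(1) by (simp add: admissible_def)
qed

lemma loss_self: "admissible g \<Longrightarrow> p \<in> W \<Longrightarrow> loss g W p p = 30"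
  using loss_white_all N_self by blast

lemma loss_white_ge: "admissible g \<Longrightarrow> v \<in> W \<Longrightarrow> v \<in> N p \<Longrightarrow> 16 \<le> loss g W p v"
  using admissible_bounds(2)[of g v "card (N v \<inter> W - N p)"] by (simp add: loss_white)

lemma loss_blue:
  "v \<notin> W \<Longrightarrow> loss g W p v = g v (card (N v \<inter> W)) - g v (card (N v \<inter> W - N p))"
  by (simp add: loss_def weight_def Int_Diff)

lemma loss_blue_all:
  assumes "admissible g" "v \<notin> W" "N v \<inter> W \<subseteq> N p"
  shows "loss g W p v = g v (card (N v \<inter> W))"
proof -
  have "card (N v \<inter> W - N p) = 0" using assms(3) by (metis Diff_eq_empty_iff card.empty)
  then have "loss g W p v = g v (card (N v \<inter> W)) - g v 0"
    using loss_blue[OF assms(2), of g p] by simp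
  then show ?thesis using assms(1) by (simp add: admissible_def)
qed

section \<open>The concrete weights and the losses they give\<close>

definition flat :: "'a \<Rightarrow> nat \<Rightarrow> int" where
  "flat v k = (if k = 0 then 0 else 14)"

text \<open>Pointwise \<open>graded C\<close> \<le> \<open>graded {}\<close> \<le>
  \<open>flat\<close>, so passing to a later weight never raises the potential. The discount on
  \<open>C\<close> makes the domination of a vertex of \<open>C\<close> worth 22 instead of 18 when
  one white neighbour remains.\<close>

definition graded :: "'a set \<Rightarrow> 'a \<Rightarrow> nat \<Rightarrow> int" where
  "graded C v k = (if k = 0 then 0 else if v \<in> C then (if k = 1 then 8 else 12)
     else if k = 1 then 12 else 14)"

lemma admissible_flat: "admissible flat"
  by (auto simp: admissible_def flat_def)

lemma admissible_graded: "admissible (graded C)"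
  by (auto simp: admissible_def graded_def)

text \<open>A white \<open>p\<close> loses 30; a dominated \<open>p\<close> loses its own 14, and a
  newly dominated neighbour at least 30 - 14 = 16.\<close>

lemma gain_flat_ge:
  assumes "W \<subseteq> V" "p \<in> V" "N p \<inter> W \<noteq> {}"
  shows "30 \<le> gain flat W p"
proof (cases "p \<in> W")
  case True
  then show ?thesis
    using gain_ge[OF admissible_flat assms(1), of "[p]" "[]" p] loss_self[OF admissible_flat True] assms(2)
    by simp
next
  case False
  obtain v where v: "v \<in> N p" "v \<in> W" using assms(3) by blast
  have "card (N p \<inter> W) \<noteq> 0" using finite_Int_N[OF assms(1)] v by auto
  then have "loss flat W p p = 14" 
    using loss_blue_all[OF admissible_flat False, of p] by (simp add: flat_def)
  moreover have "16 \<le> loss flat W p v" using loss_white_ge[OF admissible_flat] v by blast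
  moreover have "v \<in> V" "p \<noteq> v" using v assms False by auto
  ultimately show ?thesis
    using gain_ge[OF admissible_flat assms(1), of "[v]" "[p]" p] assms v False by simp
qed

text \<open>A white \<open>p\<close> yields 30 + 3 * 16 and a dominated one 14 + 4 * 16, which is 78
  in both cases.\<close>

lemma gain_flat_large:
  assumes "W \<subseteq> V" "p \<in> V" "4 \<le> card (N p \<inter> W)"
  shows "78 \<le> gain flat W p"
proof -
  obtain T where T: "T \<subseteq> N p \<inter> W - {p}" "card T = 3"
  proof (rule obtain_subset_with_card_n)
    show "3 \<le> card (N p \<inter> W - {p})" using assms(3) card_Diff_singleton_if[of "N p \<inter> W" p] by auto
  qed
  then obtain a b c where abc: "T = {a,b,c}" "a \<noteq> b" "b \<noteq> c" "a \<noteq> c"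
    by (auto simp: card_3_iff)
  have w: "16 \<le> loss flat W p v" if "v \<in> N p \<inter> W" for v
    using loss_white_ge[OF admissible_flat] that by blast
  show ?thesis
  proof (cases "p \<in> W")
    case True
    have "loss flat W p p = 30" using loss_self[OF admissible_flat True] .
    then show ?thesis
      using gain_ge[OF admissible_flat assms(1), of "[p,a,b,c]" "[]" p] w[of a] w[of b] w[of c] T abc assms True
      by auto
  next
    case False
    have "4 \<le> card (N p \<inter> W)" using assms(3) .
    then have "N p \<inter> W - T \<noteq> {}"
      using T card_mono[of T "N p \<inter> W"] abc by auto
    then obtain d where d: "d \<in> N p \<inter> W" "d \<notin> T" by blast
    have "loss flat W p p = 14" 
      using loss_blue_all[OF admissible_flat False, of p] assms(3) by (auto simp: flat_def)
    then show ?thesis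
      using gain_ge[OF admissible_flat assms(1), of "[a,b,c,d]" "[p]" p] w[of a] w[of b] w[of c] w[of d]
        T abc assms d False
      by auto
  qed
qed

text \<open>The vertex \<open>v\<close> itself leaves its white neighbourhood, so at most one white
  vertex remains there and \<open>v\<close> keeps at most 12 of its 30.\<close>

lemma loss_white_18:
  assumes "W \<subseteq> V" "v \<in> W" "v \<in> N p" "card (N v \<inter> W) \<le> 2"
  shows "18 \<le> loss (graded C) W p v"
proof -
  have "N v \<inter> W - N p \<subseteq> (N v \<inter> W) - {v}" using assms by auto
  then have "card (N v \<inter> W - N p) \<le> card ((N v \<inter> W) - {v})"
    using finite_Int_N[OF assms(1)] by (intro card_mono) auto
  also have "\<dots> = card (N v \<inter> W) - 1" using assms N_self by simp
  finally have "card (N v \<inter> W - N p) \<le> 1" using assms(4) by linarith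
  then show ?thesis using loss_white[OF assms(2,3), of "graded C"] by (auto simp: graded_def)
qed

text \<open>With at most two white neighbours, consecutive levels of the weight differ by at least
  2, and by at least 4 on \<open>C\<close>, where they are 0, 8, 12.\<close>

lemma loss_blue_hit:
  assumes "W \<subseteq> V" "y \<notin> W" "N y \<inter> W \<inter> N p \<noteq> {}" "card (N y \<inter> W) \<le> 2"
  shows "2 \<le> loss (graded C) W p y" "y \<in> C \<Longrightarrow> 4 \<le> loss (graded C) W p y"
proof -
  have "N y \<inter> W - N p \<subset> N y \<inter> W" using assms(3) by blast
  then have "card (N y \<inter> W - N p) < card (N y \<inter> W)"
    using finite_Int_N[OF assms(1)] by (intro psubset_card_mono) auto
  then show "2 \<le> loss (graded C) W p y" "y \<in> C \<Longrightarrow> 4 \<le> loss (graded C) W p y"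
    using loss_blue[OF assms(2), of "graded C" p] assms(4) by (auto simp: graded_def)
qed

text \<open>Two and three white neighbours both weigh 14, so one hit out of three would bring
  nothing; two hits reach the level 12.\<close>

lemma loss_blue_two_hits:
  assumes "W \<subseteq> V" "y \<notin> W" "y \<notin> C" "a \<noteq> b" "{a, b} \<subseteq> N y \<inter> W \<inter> N p" "card (N y \<inter> W) \<le> 3"
  shows "2 \<le> loss (graded C) W p y"
proof -
  have "N y \<inter> W - N p \<subseteq> (N y \<inter> W) - {a,b}" using assms(5) by auto
  then have "card (N y \<inter> W - N p) \<le> card ((N y \<inter> W) - {a,b})"
    using finite_Int_N[OF assms(1)] by (intro card_mono) auto
  also have "\<dots> = card (N y \<inter> W) - 2" using assms by (subst card_Diff_subset) auto
  finally have 1: "card (N y \<inter> W - N p) \<le> 1" using assms(6) by linarith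
  have "card {a,b} \<le> card (N y \<inter> W)"
    using finite_Int_N[OF assms(1)] assms(5) by (intro card_mono) auto
  then have "2 \<le> card (N y \<inter> W)" using assms(4) by simp
  then show ?thesis using loss_blue[OF assms(2), of "graded C" p] 1 assms(3) by (auto simp: graded_def)
qed

section \<open>Positions with white degree at most two\<close>

text \<open>A dominated vertex that is played sees no white vertex afterwards and loses its entire
  weight.\<close>

lemma loss_center:
  assumes "W \<subseteq> V" "p \<notin> W" "N p \<inter> W \<noteq> {}"
  shows "8 \<le> loss (graded C) W p p" "p \<notin> C \<Longrightarrow> 12 \<le> loss (graded C) W p p"
    "2 \<le> card (N p \<inter> W) \<Longrightarrow> 12 \<le> loss (graded C) W p p"
    "2 \<le> card (N p \<inter> W) \<Longrightarrow> p \<notin> C \<Longrightarrow> 14 \<le> loss (graded C) W p p"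
proof -
  have "card (N p \<inter> W) \<noteq> 0" using finite_Int_N[OF assms(1)] assms(3) by auto
  then show "8 \<le> loss (graded C) W p p" "p \<notin> C \<Longrightarrow> 12 \<le> loss (graded C) W p p"
    "2 \<le> card (N p \<inter> W) \<Longrightarrow> 12 \<le> loss (graded C) W p p"
    "2 \<le> card (N p \<inter> W) \<Longrightarrow> p \<notin> C \<Longrightarrow> 14 \<le> loss (graded C) W p p"
    using loss_blue_all[OF admissible_graded assms(2), of p C] by (auto simp: graded_def)
qed

lemma gain_graded_ge:
  assumes "W \<subseteq> V" "p \<in> V" "N p \<inter> W \<noteq> {}"
  shows "28 \<le> gain (graded {}) W p"
proof (cases "p \<in> W")
  case True
  then show ?thesis
    using gain_ge[OF admissible_graded assms(1), of "[p]" "[]" "{}" p] loss_self[OF admissible_graded True] assms(2)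
    by simp
next
  case False
  obtain v where v: "v \<in> N p" "v \<in> W" using assms(3) by blast
  have "12 \<le> loss (graded {}) W p p" using loss_center[OF assms(1) False assms(3)] by simp
  moreover have "16 \<le> loss (graded {}) W p v" using loss_white_ge[OF admissible_graded] v by blast
  moreover have "v \<in> V" "p \<noteq> v" using v assms False by auto
  ultimately show ?thesis
    using gain_ge[OF admissible_graded assms(1), of "[v]" "[p]" "{}" p] assms v False by simp
qed

lemma common_neighbour:
  assumes "v \<in> V" "u \<in> N v" "u \<noteq> v"
  obtains w where "w \<in> V" "w \<in> N u" "w \<in> N v" "u \<in> N w" "v \<in> N w" "w \<noteq> u" "w \<noteq> v"
  using triangle[OF assms(2,3)] N_subset[OF assms(1)] N_sym by blast

text \<open>Since closed neighbourhoods contain at most three white vertices, the triangle has no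
  white neighbours outside itself, and all three vertices drop from 30 to 0.\<close>

lemma gain_white_triangle:
  assumes "W \<subseteq> V" "\<forall>x\<in>V. card (N x \<inter> W) \<le> 3" "v \<in> W" "N v \<inter> W = {v, a, b}"
    "a \<noteq> v" "b \<noteq> v" "a \<noteq> b" "b \<in> N a"
  shows "80 \<le> gain (graded {}) W v"
proof -
  have *: "N x \<inter> W = {v, a, b}" if "x \<in> W" "{v, a, b} \<subseteq> N x \<inter> W" for x
  proof (rule sym, rule card_seteq)
    have "card (N x \<inter> W) \<le> 3" using assms(1,2) that(1) by blast
    then show "card (N x \<inter> W) \<le> card {v,a,b}" using assms(5-7) by simp
  qed (use that finite_Int_N[OF assms(1)] in auto)
  have ab: "a \<in> W" "b \<in> W" "a \<in> N v" "b \<in> N v" using assms by auto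
  have "v \<in> N a" "v \<in> N b" "a \<in> N b" using ab assms(8) N_sym by auto
  then have "N a \<inter> W = {v,a,b}" "N b \<inter> W = {v,a,b}"
    using *[of a] *[of b] ab assms N_self by auto
  then have "N a \<inter> W \<subseteq> N v" "N b \<inter> W \<subseteq> N v" using assms(4) by blast+
  then have "loss (graded {}) W v a = 30" "loss (graded {}) W v b = 30"
    using loss_white_all[OF admissible_graded] ab by blast+
  then show ?thesis
    using gain_ge[OF admissible_graded assms(1), of "[v,a,b]" "[]" "{}" v]
      loss_self[OF admissible_graded assms(3), of "{}"] assms ab by auto
qed

text \<open>The losses are 30 for \<open>v\<close>, 30 for \<open>a\<close>, whose only white
  neighbour is \<open>v\<close>, 18 for \<open>b\<close>, and 2 for a dominated common neighbour of
  \<open>v\<close> and \<open>a\<close>.\<close>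

lemma gain_path_end:
  assumes "W \<subseteq> V" "\<forall>x\<in>V. card (N x \<inter> W) \<le> 3" "v \<in> W" "N v \<inter> W = {v, a, b}"
    "a \<noteq> v" "b \<noteq> v" "a \<noteq> b" "b \<notin> N a" "card (N a \<inter> W) \<le> 2"
  shows "80 \<le> gain (graded {}) W v"
proof -
  have ab: "a \<in> W" "b \<in> W" "a \<in> N v" "b \<in> N v" "v \<in> V" using assms by auto
  have va: "v \<in> N a" "v \<in> N b" using ab N_sym by auto
  have "N a \<inter> W = {v, a}"
  proof (rule sym, rule card_seteq)
    show "{v,a} \<subseteq> N a \<inter> W" using va ab N_self assms by auto
  qed (use assms finite_Int_N[OF assms(1)] in auto)
  then have "loss (graded {}) W v a = 30"
    using loss_white_all[OF admissible_graded, of a] ab N_self by auto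
  moreover have "18 \<le> loss (graded {}) W v b"
  proof -
    have "card (N b \<inter> W - N v) \<le> card (N b \<inter> W - {v, b})"
      using finite_Int_N[OF assms(1)] ab N_self by (intro card_mono) auto
    also have "\<dots> = card (N b \<inter> W) - 2"
      using va ab N_self assms by (subst card_Diff_subset) auto
    also have "\<dots> \<le> 1"
    proof -
      have "card (N b \<inter> W) \<le> 3" using assms(1,2) ab(2) by blast
      then show ?thesis by linarith
    qed
    finally show ?thesis using loss_white[of b W v "graded {}"] ab by (auto simp: graded_def)
  qed
  moreover obtain t where t: "t \<in> V" "t \<in> N a" "t \<in> N v" "a \<in> N t" "v \<in> N t" "t \<noteq> a" "t \<noteq> v"
    using common_neighbour[OF ab(5) ab(3) assms(5)] by blast
  \<comment> \<open>As \<open>b\<close> is not adjacent to \<open>a\<close>, the third vertex of the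
    triangle on \<open>v\<close> and \<open>a\<close> is not white.\<close>
  have "t \<noteq> b" using t assms(8) by auto
  then have tW: "t \<notin> W" using t assms(4) by blast
  moreover have "2 \<le> loss (graded {}) W v t"
    using loss_blue_two_hits[of W t "{}" a v v] assms(1,2,3,5) t tW ab N_self by auto
  ultimately show ?thesis
    using gain_ge[OF admissible_graded assms(1), of "[v,a,b]" "[t]" "{}" v]
      loss_self[OF admissible_graded assms(3), of "{}"] assms ab t \<open>t \<noteq> b\<close> by auto
qed

section \<open>Removing the white cycles\<close>

text \<open>
\<open>C\<close> is the vertex set of the white cycles at the time they were fixed: it stays the same while
\<open>W\<close> shrinks, so its vertices may since have been dominated.
\<close>
definition cyclic :: "'a set \<Rightarrow> 'a set \<Rightarrow> bool" where
  "cyclic C W \<longleftrightarrow>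
     (\<forall>v\<in>V. card (N v \<inter> W) \<le> 3) \<and>
     (\<forall>v\<in>W - C. card (N v \<inter> W) \<le> 2 \<and> N v \<inter> W \<inter> C = {}) \<and> C \<subseteq> V \<and>
     (\<forall>v\<in>C. \<exists>a b. a \<noteq> v \<and> b \<noteq> v \<and> a \<noteq> b \<and> b \<notin> N a \<and> N v \<inter> C = {v, a, b} \<and> N v \<inter> W \<subseteq> {v, a, b})"

text \<open>The conditions bound white vertices and their white neighbourhoods only from above;
  everything else concerns the fixed set \<open>C\<close>.\<close>

lemma cyclic_mono:
  assumes "W \<subseteq> V" "cyclic C W" "W' \<subseteq> W"
  shows "cyclic C W'"
proof -
  have le: "card (N v \<inter> W') \<le> card (N v \<inter> W)" for v
    using finite_Int_N[OF assms(1)] assms(3) by (intro card_mono) auto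
  have c: "\<forall>v\<in>V. card (N v \<inter> W) \<le> 3" "C \<subseteq> V"
    "\<forall>v\<in>W - C. card (N v \<inter> W) \<le> 2 \<and> N v \<inter> W \<inter> C = {}"
    "\<forall>v\<in>C. \<exists>a b. a \<noteq> v \<and> b \<noteq> v \<and> a \<noteq> b \<and> b \<notin> N a \<and> N v \<inter> C = {v, a, b} \<and> N v \<inter> W \<subseteq> {v, a, b}"
    using assms(2) by (simp_all add: cyclic_def)
  show ?thesis
    unfolding cyclic_def
  proof (intro conjI ballI)
    fix v assume "v \<in> V"
    then show "card (N v \<inter> W') \<le> 3" using le[of v] c(1) by (meson order_trans)
  next
    fix v assume "v \<in> W' - C"
    then have v: "v \<in> W - C" using assms(3) by blast
    show "card (N v \<inter> W') \<le> 2" using le[of v] c(3) v by (meson order_trans)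
    show "N v \<inter> W' \<inter> C = {}" using c(3) v assms(3) by blast
  next
    fix v assume "v \<in> C"
    then obtain a b where "a \<noteq> v \<and> b \<noteq> v \<and> a \<noteq> b \<and> b \<notin> N a \<and> N v \<inter> C = {v, a, b} \<and> N v \<inter> W \<subseteq> {v, a, b}"
      using c(4) by blast
    moreover have "N v \<inter> W' \<subseteq> N v \<inter> W" using assms(3) by blast
    ultimately show "\<exists>a b. a \<noteq> v \<and> b \<noteq> v \<and> a \<noteq> b \<and> b \<notin> N a \<and> N v \<inter> C = {v, a, b} \<and> N v \<inter> W' \<subseteq> {v, a, b}"
      using subset_trans by metis
  qed (rule c(2))
qed

section \<open>Neighbourhoods and gains around the white cycles\<close>

context
  fixes C W
  assumes cyc: "cyclic C W" and W: "W \<subseteq> V"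
begin

lemma cyclic_card3: "v \<in> V \<Longrightarrow> card (N v \<inter> W) \<le> 3"
  and cyclic_subset: "C \<subseteq> V"
  and cyclic_out: "v \<in> W \<Longrightarrow> v \<notin> C \<Longrightarrow> card (N v \<inter> W) \<le> 2 \<and> N v \<inter> W \<inter> C = {}"
  and cyclic_ex: "v \<in> C \<Longrightarrow> \<exists>a b. a \<noteq> v \<and> b \<noteq> v \<and> a \<noteq> b \<and> b \<notin> N a \<and>
    N v \<inter> C = {v, a, b} \<and> N v \<inter> W \<subseteq> {v, a, b}"
  using cyc by (simp_all add: cyclic_def)

lemma cyclic_neighbours:
  assumes "v \<in> C"
  obtains a b where "a \<noteq> v" "b \<noteq> v" "a \<noteq> b" "b \<notin> N a" "a \<notin> N b" "a \<in> C" "b \<in> C" "a \<in> N v" "b \<in> N v"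
    "N v \<inter> C = {v, a, b}" "N v \<inter> W \<subseteq> {v, a, b}"
proof -
  obtain a b where ab: "a \<noteq> v" "b \<noteq> v" "a \<noteq> b" "b \<notin> N a" "N v \<inter> C = {v, a, b}" "N v \<inter> W \<subseteq> {v, a, b}"
    using cyclic_ex[OF assms] by blast
  have "a \<notin> N b" using ab(4) N_sym by blast
  moreover have "a \<in> C" "b \<in> C" "a \<in> N v" "b \<in> N v" using ab(5) by blast+
  ultimately show thesis by (intro that[of a b] ab)
qed

text \<open>Apart from \<open>v\<close> itself, \<open>N v\<close> meets \<open>C\<close> and
  \<open>W\<close> only in two cycle neighbours, which are not adjacent. So the third vertex of a
  triangle on a cycle edge is dominated and carries the higher weights used outside
  \<open>C\<close>.\<close>

lemma cyclic_no_triangle: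
  assumes "u \<in> C" "v \<in> C" "u \<noteq> v" "u \<in> N v" "t \<in> N u" "t \<in> N v" "t \<noteq> u" "t \<noteq> v"
  shows "t \<notin> C" "t \<notin> W"
proof -
  obtain a b where ab: "b \<notin> N a" "a \<notin> N b" "N v \<inter> C = {v, a, b}" "N v \<inter> W \<subseteq> {v, a, b}"
    using cyclic_neighbours[OF assms(2)] by metis
  have u: "u = a \<or> u = b" using assms ab(3) by blast
  have "t \<notin> {v,a,b}" using u assms(5,7,8) ab(1,2) by blast
  then show "t \<notin> C" "t \<notin> W" using ab assms(6) by blast+
qed

lemma cyclic_in: "v \<in> C \<Longrightarrow> N v \<inter> W \<subseteq> C"
  by (erule cyclic_neighbours) blast

lemma cyclic_white_out: "v \<in> W \<Longrightarrow> v \<notin> C \<Longrightarrow> v \<in> N x \<Longrightarrow> x \<notin> C"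
  using cyclic_in[of x] by blast

lemma card_N_blue_C:
  assumes "v \<in> C" "v \<notin> W"
  shows "card (N v \<inter> W) \<le> 2"
proof -
  obtain a b where "N v \<inter> W \<subseteq> {v, a, b}" using cyclic_neighbours[OF assms(1)] by metis
  then have "N v \<inter> W \<subseteq> {a, b}" using assms(2) by blast
  then have "card (N v \<inter> W) \<le> card {a,b}" by (intro card_mono) auto
  also have "\<dots> \<le> 2" by (simp add: card_insert_if)
  finally show ?thesis .
qed

lemma card_N_C_remaining:
  assumes "v \<in> C" "p \<in> C" "p \<in> N v" "p \<noteq> v"
  shows "card (N v \<inter> W - {v, p}) \<le> 1"
proof -
  obtain a b where ab: "N v \<inter> C = {v, a, b}" "N v \<inter> W \<subseteq> {v, a, b}"
    using cyclic_neighbours[OF assms(1)] by metis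
  have "p = a \<or> p = b" using ab assms by blast
  then obtain c where "N v \<inter> W - {v, p} \<subseteq> {c}" using ab by blast
  then have "card (N v \<inter> W - {v, p}) \<le> card {c}" by (intro card_mono) auto
  then show ?thesis by simp
qed

text \<open>A white \<open>p\<close> gives 30, and a dominated \<open>p\<close> with two white
  neighbours 12 + 16 + 16. With a single white neighbour the sum is 8 + 22 if \<open>p\<close> is in
  \<open>C\<close> and 12 + 18 otherwise.\<close>

lemma gain_cyclic_ge:
  assumes "p \<in> V" "N p \<inter> W \<noteq> {}"
  shows "30 \<le> gain (graded C) W p"
proof (cases "p \<in> W")
  case True
  then show ?thesis
    using gain_ge[OF admissible_graded W, of "[p]" "[]" C p] loss_self[OF admissible_graded True] assms(1)
    by simp
next
  case False
  obtain v where v: "v \<in> N p" "v \<in> W" using assms(2) by blast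
  have vV: "v \<in> V" "v \<noteq> p" using v W False by auto
  show ?thesis
  proof (cases "2 \<le> card (N p \<inter> W)")
    case True
    have "12 \<le> loss (graded C) W p p" using loss_center(3)[OF W False assms(2) True] .
    moreover have "\<not> N p \<inter> W \<subseteq> {v}"
      using True card_mono[of "{v}" "N p \<inter> W"] by auto
    then obtain w where w: "w \<in> N p \<inter> W" "w \<noteq> v" by blast
    moreover have "16 \<le> loss (graded C) W p v" "16 \<le> loss (graded C) W p w"
      using loss_white_ge[OF admissible_graded] v w by auto
    ultimately show ?thesis
      using gain_ge[OF admissible_graded W, of "[v,w]" "[p]" C p] assms vV v W False by auto
  next
    case False': False
    show ?thesis
    proof (cases "p \<in> C")
      case True
      have "v \<in> C" using cyclic_in[OF True] v by blast
      \<comment> \<open>\<open>p\<close> is one of the two cycle neighbours of \<open>v\<close>, so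
        \<open>v\<close> sees at most one white vertex afterwards and keeps at most 8.\<close>
      then have "card (N v \<inter> W - {v, p}) \<le> 1"
        using card_N_C_remaining[of v p] True v vV N_sym by auto
      moreover have "card (N v \<inter> W - N p) \<le> card (N v \<inter> W - {v, p})"
        using finite_Int_N[OF W] v N_self by (intro card_mono) auto
      ultimately have "22 \<le> loss (graded C) W p v"
        using loss_white[of v W p "graded C"] v \<open>v \<in> C\<close> by (auto simp: graded_def)
      moreover have "8 \<le> loss (graded C) W p p" using loss_center(1)[OF W False assms(2)] .
      ultimately show ?thesis
        using gain_ge[OF admissible_graded W, of "[v]" "[p]" C p] assms vV v \<open>p \<notin> W\<close> by auto
    next
      case pC: False
      have "18 \<le> loss (graded C) W p v"
      proof (cases "v \<in> C")
        case True
        then show ?thesis using loss_white[of v W p "graded C"] v by (auto simp: graded_def)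
      next
        case False
        then show ?thesis using loss_white_18[OF W v(2,1)] cyclic_out[OF v(2)] by blast
      qed
      moreover have "12 \<le> loss (graded C) W p p" using loss_center(2)[OF W False assms(2) pC] .
      ultimately show ?thesis
        using gain_ge[OF admissible_graded W, of "[v]" "[p]" C p] assms vV v \<open>p \<notin> W\<close> by auto
    qed
  qed
qed

text \<open>The vertex and its two white neighbours lose 30 + 22 + 22. The triangles on the two
  cycle edges at \<open>v\<close> have either the same third vertex, which loses 14, or two
  different ones, which lose 2 each; the latter case is tight.\<close>

lemma gain_cycle_vertex:
  assumes "v \<in> W" "v \<in> C" "card (N v \<inter> W) = 3"
  shows "78 \<le> gain (graded C) W v"
proof -
  obtain a b where ab: "a \<noteq> v" "b \<noteq> v" "a \<noteq> b" "b \<notin> N a" "a \<notin> N b" "a \<in> C" "b \<in> C" "a \<in> N v" "b \<in> N v"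
    and N: "N v \<inter> C = {v, a, b}" "N v \<inter> W \<subseteq> {v, a, b}"
    by (rule cyclic_neighbours[OF assms(2)])
  have "N v \<inter> W = {v,a,b}"
    by (rule card_seteq) (use N ab assms in auto)
  then have abW: "a \<in> W" "b \<in> W" by auto
  have V: "v \<in> V" "a \<in> V" "b \<in> V" using W assms abW by auto
  have l: "22 \<le> loss (graded C) W v c" if c: "c \<in> C" "c \<in> W" "c \<in> N v" "c \<noteq> v" for c
  proof -
    have "card (N c \<inter> W - {c, v}) \<le> 1"
      using card_N_C_remaining[of c v] c assms N_sym by blast
    moreover have "card (N c \<inter> W - N v) \<le> card (N c \<inter> W - {c, v})"
      using finite_Int_N[OF W] c N_self by (intro card_mono) auto
    ultimately show ?thesis
      using loss_white[of c W v "graded C"] c by (auto simp: graded_def)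
  qed
  have la: "22 \<le> loss (graded C) W v a" and lb: "22 \<le> loss (graded C) W v b"
    using l ab(1,2,6-9) abW by blast+
  obtain s where s: "s \<in> V" "s \<in> N a" "s \<in> N v" "a \<in> N s" "v \<in> N s" "s \<noteq> a" "s \<noteq> v"
    using common_neighbour[OF V(1) ab(8) ab(1)] by blast
  obtain t where t: "t \<in> V" "t \<in> N b" "t \<in> N v" "b \<in> N t" "v \<in> N t" "t \<noteq> b" "t \<noteq> v"
    using common_neighbour[OF V(1) ab(9) ab(2)] by blast
  have sC: "s \<notin> C" "s \<notin> W" using cyclic_no_triangle[of a v s] ab assms s by blast+
  have tC: "t \<notin> C" "t \<notin> W" using cyclic_no_triangle[of b v t] ab assms t by blast+
  have lossv: "loss (graded C) W v v = 30" using loss_self[OF admissible_graded assms(1)] .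
  show ?thesis
  proof (cases "s = t")
    case True
    have "N s \<inter> W = {v,a,b}"
      by (rule sym, rule card_seteq) (use s t True abW assms ab cyclic_card3[OF t(1)] finite_Int_N[OF W] in auto)
    then have ls: "loss (graded C) W v s = 14"
      using loss_blue_all[OF admissible_graded sC(2), of v C] ab N_self sC by (auto simp: graded_def)
    then show ?thesis
      using gain_ge[OF admissible_graded W, of "[v,a,b]" "[s]" C v] lossv la lb V s ab(1-3) abW sC assms(1) ls
      by simp
  next
    case False
    have "2 \<le> loss (graded C) W v s"
      using loss_blue_two_hits[OF W sC(2) sC(1), of a v v] s abW ab N_self assms cyclic_card3 by auto
    moreover have "2 \<le> loss (graded C) W v t"
      using loss_blue_two_hits[OF W tC(2) tC(1), of b v v] t abW ab N_self assms cyclic_card3 by auto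
    ultimately show ?thesis
      using gain_ge[OF admissible_graded W, of "[v,a,b]" "[s,t]" C v] lossv la lb V s t ab(1-3) abW sC tC False assms(1)
      by simp
  qed
qed

section \<open>Positions in which a white vertex has at most one white neighbour\<close>

context
  assumes deg: "\<And>v. v \<in> W \<Longrightarrow> card (N v \<inter> W) \<le> 2"
begin

lemma N_white_pair:
  assumes "u \<in> W" "v \<in> W" "v \<in> N u" "u \<noteq> v"
  shows "N u \<inter> W = {u, v}"
  by (rule sym, rule card_seteq) (use assms deg[OF assms(1)] N_self finite_Int_N[OF W] in auto)

lemma card3_blue:
  assumes "x \<in> V" "2 < card (N x \<inter> W)"
  shows "x \<notin> W" "x \<notin> C" "card (N x \<inter> W) = 3"
proof -
  show xW: "x \<notin> W" using deg[of x] assms(2) by linarith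
  show "x \<notin> C" using card_N_blue_C[of x] xW assms(2) by linarith
  show "card (N x \<inter> W) = 3" using cyclic_card3[OF assms(1)] assms(2) by linarith
qed

text \<open>The vertex \<open>u\<close> loses 30 because its white neighbours are dominated along
  with it; the other two white vertices lose 18 each and \<open>x\<close> loses 14.\<close>

lemma gain_blue_triple:
  assumes "x \<in> V" "2 < card (N x \<inter> W)" "u \<in> W" "u \<in> N x" "N u \<inter> W \<subseteq> N x"
  shows "78 \<le> gain (graded C) W x"
proof -
  note x = card3_blue[OF assms(1,2)]
  have "card (N x \<inter> W - {u}) = 2" using x assms by simp
  then obtain a b where ab: "N x \<inter> W - {u} = {a, b}" "a \<noteq> b" by (auto simp: card_2_iff)
  have abW: "a \<in> W" "a \<in> N x" "b \<in> W" "b \<in> N x" "a \<noteq> u" "b \<noteq> u" using ab by blast+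
  have "loss (graded C) W x u = 30" using loss_white_all[OF admissible_graded] assms by blast
  moreover have "18 \<le> loss (graded C) W x a" "18 \<le> loss (graded C) W x b"
    using loss_white_18[OF W] deg abW by auto
  moreover have "14 \<le> loss (graded C) W x x"
    using loss_center(4)[OF W x(1), of C] x assms by auto
  ultimately show ?thesis
    using gain_ge[OF admissible_graded W, of "[u,a,b]" "[x]" C x] abW ab(2) x assms W by auto
qed

text \<open>Let \<open>t\<close> complete a triangle on \<open>u\<close> and \<open>v\<close>. If
  \<open>t\<close> sees a third white vertex, then \<open>t\<close> is the move. Otherwise
  \<open>u\<close> is: the pair loses 60, \<open>t\<close> loses 14, and the dominated cycle
  neighbour of \<open>u\<close> other than \<open>v\<close> loses at least 4.\<close>

lemma gain_white_pair_C:
  assumes "u \<in> W" "v \<in> W" "v \<in> N u" "u \<noteq> v" "u \<in> C"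
  shows "\<exists>x\<in>V. 78 \<le> gain (graded C) W x"
proof -
  have V: "u \<in> V" "v \<in> V" using assms W by auto
  have vC: "v \<in> C" using cyclic_in[OF assms(5)] assms by blast
  obtain t where t: "t \<in> V" "t \<in> N v" "t \<in> N u" "v \<in> N t" "u \<in> N t" "t \<noteq> v" "t \<noteq> u"
    using common_neighbour[OF V(1) assms(3)] assms(4) by blast
  have tC: "t \<notin> C" "t \<notin> W" using cyclic_no_triangle[of v u t] vC assms t by blast+
  have Nu: "N u \<inter> W = {u, v}" "N v \<inter> W = {v, u}"
    using N_white_pair assms N_sym by auto
  show ?thesis
  proof (cases "2 < card (N t \<inter> W)")
    case True
    then show ?thesis using gain_blue_triple[of t u] t Nu assms by auto
  next
    case False
    then have Nt: "N t \<inter> W = {u, v}"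
      by (intro sym[OF card_seteq]) (use t assms finite_Int_N[OF W] in auto)
    obtain a b where ab: "a \<noteq> u" "b \<noteq> u" "a \<noteq> b" "a \<in> C" "b \<in> C" "a \<in> N u" "b \<in> N u"
      "N u \<inter> C = {u, a, b}"
      using cyclic_neighbours[OF assms(5)] by metis
    obtain c where c: "c \<in> C" "c \<in> N u" "c \<noteq> u" "c \<noteq> v"
      using ab by metis
    then have cW: "c \<notin> W" using Nu by blast
    have uc: "u \<in> N c" using c N_sym by blast
    have "4 \<le> loss (graded C) W u c"
      using loss_blue_hit(2)[OF W cW, of u C] uc assms(1) N_self c card_N_blue_C[OF c(1) cW] by auto
    moreover have "14 \<le> loss (graded C) W u t"
      using loss_blue_all[OF admissible_graded tC(2), of u C] Nt N_self assms tC by (auto simp: graded_def)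
    moreover have "loss (graded C) W u v = 30"
      using loss_white_all[OF admissible_graded assms(2,3)] Nu assms N_self by auto
    moreover have "t \<noteq> c" "c \<in> V" using tC c cyclic_subset by blast+
    ultimately have "78 \<le> gain (graded C) W u"
      using gain_ge[OF admissible_graded W, of "[u,v]" "[t,c]" C u] loss_self[OF admissible_graded assms(1), of C]
        V t tC cW assms by simp
    then show ?thesis using V by blast
  qed
qed

text \<open>When no move gains 78, the pair lies outside \<open>C\<close>, and the third vertex
  \<open>t\<close> of a triangle on it sees no other white vertex, which gives 30 + 30 + 14 = 74.
  Any further dominated vertex adds its own loss, as only \<open>u\<close>, \<open>v\<close> and
  \<open>t\<close> have been counted.\<close>

lemma gain_white_pair:
  assumes "u \<in> W" "v \<in> W" "v \<in> N u" "u \<noteq> v" "\<And>x. x \<in> V \<Longrightarrow> gain (graded C) W x < 78"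
  obtains t where "t \<in> V" "t \<notin> W" "t \<notin> C" "N t \<inter> W = {u, v}" "74 \<le> gain (graded C) W u"
    "\<And>x. x \<in> V \<Longrightarrow> x \<notin> W \<Longrightarrow> x \<noteq> t \<Longrightarrow> u \<in> N x \<or> v \<in> N x \<Longrightarrow>
       74 + loss (graded C) W u x \<le> gain (graded C) W u"
proof -
  have V: "u \<in> V" "v \<in> V" using assms W by auto
  have nC: "u \<notin> C" "v \<notin> C"
    using gain_white_pair_C[of u v] gain_white_pair_C[of v u] assms N_sym by fastforce+
  obtain t where t: "t \<in> V" "t \<in> N v" "t \<in> N u" "v \<in> N t" "u \<in> N t" "t \<noteq> v" "t \<noteq> u"
    using common_neighbour[OF V(1) assms(3)] assms(4) by blast
  have Nu: "N u \<inter> W = {u, v}" "N v \<inter> W = {v, u}"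
    using N_white_pair assms N_sym by auto
  have tW: "t \<notin> W" using t Nu by blast
  have tC: "t \<notin> C" using cyclic_white_out[of u t] assms nC t by blast
  have "\<not> 2 < card (N t \<inter> W)" using gain_blue_triple[of t u] t Nu assms by force
  then have Nt: "N t \<inter> W = {u, v}"
    by (intro sym[OF card_seteq]) (use t assms finite_Int_N[OF W] in auto)
  have lt: "14 \<le> loss (graded C) W u t"
    using loss_blue_all[OF admissible_graded tW, of u C] Nt N_self assms tC by (auto simp: graded_def)
  have lv: "loss (graded C) W u v = 30"
    using loss_white_all[OF admissible_graded assms(2,3)] Nu assms N_self by auto
  have lu: "loss (graded C) W u u = 30" using loss_self[OF admissible_graded assms(1)] .
  have "74 \<le> gain (graded C) W u"
    using gain_ge[OF admissible_graded W, of "[u,v]" "[t]" C u] lt lv lu V t(1) tW assms(1,2,4) by simp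
  moreover have "74 + loss (graded C) W u x \<le> gain (graded C) W u"
    if "x \<in> V" "x \<notin> W" "x \<noteq> t" for x
  proof -
    have "x \<noteq> u" "x \<noteq> v" using that assms by auto
    then show ?thesis
      using gain_ge[OF admissible_graded W, of "[u,v]" "[t,x]" C u] lt lv lu V t(1) tW assms(1,2,4) that by simp
  qed
  ultimately show thesis using that t(1) tW tC Nt by blast
qed

text \<open>Such an \<open>x\<close> would add at least 8 to the 74 gained by playing
  \<open>u\<close>.\<close>

lemma white_pair_no_private:
  assumes "u \<in> W" "v \<in> W" "v \<in> N u" "u \<noteq> v" "\<And>x. x \<in> V \<Longrightarrow> gain (graded C) W x < 78"
    "x \<in> V" "x \<notin> W"
  shows "N x \<inter> W \<noteq> {u}"
proof
  assume Nx: "N x \<inter> W = {u}"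
  obtain t where t: "N t \<inter> W = {u, v}"
    and g: "\<And>x. x \<in> V \<Longrightarrow> x \<notin> W \<Longrightarrow> x \<noteq> t \<Longrightarrow> u \<in> N x \<or> v \<in> N x \<Longrightarrow>
       74 + loss (graded C) W u x \<le> gain (graded C) W u"
    using gain_white_pair[OF assms(1-5)] by metis
  have "x \<noteq> t" using t Nx assms(4) by auto
  moreover have "8 \<le> loss (graded C) W u x"
    using loss_blue_all[OF admissible_graded assms(7), of u C] Nx N_self by (auto simp: graded_def)
  ultimately show False using g[of x] assms(5)[of u] assms Nx W by force
qed

text \<open>The vertices \<open>y\<close> and \<open>z\<close> form a triangle with
  \<open>v\<close>. As \<open>v\<close> has no white neighbour, three white vertices next to
  \<open>y\<close> or \<open>z\<close> would allow a gain of 78 by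
  \<open>gain_blue_triple\<close>.\<close>

lemma isolated_white_neighbours:
  assumes "v \<in> W" "N v \<inter> W = {v}" "\<And>x. x \<in> V \<Longrightarrow> gain (graded C) W x < 78"
  obtains y z where "y \<in> V" "z \<in> V" "y \<noteq> z" "y \<notin> W" "z \<notin> W" "v \<in> N y" "v \<in> N z"
    "y \<in> N v" "z \<in> N v" "z \<in> N y" "card (N y \<inter> W) \<le> 2" "card (N z \<inter> W) \<le> 2"
proof -
  have V: "v \<in> V" using assms W by auto
  obtain y where y: "y \<in> N v" "y \<noteq> v" using not_isolated[OF V] by blast
  obtain z where z: "z \<in> V" "z \<in> N y" "z \<in> N v" "y \<in> N z" "v \<in> N z" "z \<noteq> y" "z \<noteq> v"
    using common_neighbour[OF V y] by blast
  have yz: "y \<notin> W" "z \<notin> W" "y \<in> V" "v \<in> N y" using y z assms N_subset[OF V] N_sym by auto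
  have "card (N x \<inter> W) \<le> 2" if "x \<in> V" "v \<in> N x" for x
    using gain_blue_triple[of x v] that assms by force
  then show thesis using that y z yz by blast
qed

text \<open>
Here Dominator may gain only 74. Every reply is worth 34 except for a dominated vertex \<open>p\<close> whose
only white neighbour belongs to another white pair; such a \<open>p\<close> was not available before Dominator's
move, so it was a neighbour of \<open>u\<close> or \<open>v\<close> and Dominator gained 2 on it.
\<close>
lemma white_pair_round:
  assumes "u \<in> W" "v \<in> W" "v \<in> N u" "u \<noteq> v" "\<And>x. x \<in> V \<Longrightarrow> gain (graded C) W x < 78"
    "p \<in> V" "N p \<inter> (W - N u) \<noteq> {}"
  shows "108 \<le> gain (graded C) W u + gain (graded C) (W - N u) p"
proof -
  define W' where "W' = W - N u"
  obtain t where t: "t \<in> V" "t \<notin> W" "t \<notin> C" "N t \<inter> W = {u, v}" 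
    and g: "74 \<le> gain (graded C) W u"
    "\<And>x. x \<in> V \<Longrightarrow> x \<notin> W \<Longrightarrow> x \<noteq> t \<Longrightarrow> u \<in> N x \<or> v \<in> N x \<Longrightarrow>
       74 + loss (graded C) W u x \<le> gain (graded C) W u"
    using gain_white_pair[OF assms(1-5)] by metis
  have W'V: "W' \<subseteq> V" using W W'_def by auto
  have Nu: "N u \<inter> W = {u, v}" "N v \<inter> W = {v, u}"
    using N_white_pair assms N_sym by auto
  have W': "W' = W - {u, v}" using Nu by (auto simp: W'_def)
  \<comment> \<open>The pair is a component of the white graph, so the white neighbourhoods of the
    remaining white vertices do not change.\<close>
  have NW': "N w \<inter> W' = N w \<inter> W" if "w \<in> W'" for w
    using that Nu N_sym W' by blast
  have W'W: "w \<in> W' \<Longrightarrow> w \<in> W" for w using W' by auto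
  have deg': "card (N w \<inter> W') \<le> 2" if "w \<in> W'" for w using NW'[OF that] deg that W' by auto
  have gp: "(\<Sum>v\<leftarrow>xs. loss (graded C) W' p v) + (\<Sum>v\<leftarrow>ys. loss (graded C) W' p v)
      \<le> gain (graded C) W' p"
    if "distinct xs" "set xs \<subseteq> W'" "distinct ys" "set ys \<subseteq> V - W'" for xs ys
    using gain_ge[OF admissible_graded W'V that] .
  have le: "card (N y \<inter> W') \<le> card (N y \<inter> W)" for y
    using finite_Int_N[OF W] W' by (intro card_mono) auto
  show ?thesis
  proof (cases "p \<in> W'")
    case True
    have lp: "loss (graded C) W' p p = 30" using loss_self[OF admissible_graded True] .
    show ?thesis
    proof (cases "N p \<inter> W = {p}")
      \<comment> \<open>Here 30 for \<open>p\<close> and 2 for each of two dominated neighbours make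
        34.\<close>
      case single: True
      obtain y z where yz: "y \<in> V" "z \<in> V" "y \<noteq> z" "y \<notin> W" "z \<notin> W" "p \<in> N y" "p \<in> N z"
        "y \<in> N p" "z \<in> N p" "card (N y \<inter> W) \<le> 2" "card (N z \<inter> W) \<le> 2"
        using isolated_white_neighbours[OF W'W[OF True] single] assms(5) by metis
      have "2 \<le> loss (graded C) W' p y"
        using loss_blue_hit(1)[OF W'V, of y p C] yz True N_self le[of y] W'W by fastforce
      moreover have "2 \<le> loss (graded C) W' p z"
        using loss_blue_hit(1)[OF W'V, of z p C] yz True N_self le[of z] W'W by fastforce
      moreover have "y \<notin> W'" "z \<notin> W'" using yz W'W by blast+
      ultimately have "34 \<le> gain (graded C) W' p"
        using gp[of "[p]" "[y,z]"] lp yz True W'W assms(6) by auto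
      then show ?thesis using g(1) unfolding W'_def by linarith
    next
      case False
      then obtain q where q: "q \<in> W" "q \<in> N p" "q \<noteq> p" using N_self True W' by blast
      have qW': "q \<in> W'" using NW'[OF True] q by blast
      have "N q \<inter> W = {q, p}" using N_white_pair[of q p] q True W'W N_sym by auto
      moreover have "N q \<inter> W' \<subseteq> N q \<inter> W" using W' by blast
      ultimately have "N q \<inter> W' \<subseteq> {q, p}" by simp
      also have "\<dots> \<subseteq> N p" using q(2) N_self by simp
      finally have "N q \<inter> W' \<subseteq> N p" .
      then have "loss (graded C) W' p q = 30"
        using loss_white_all[OF admissible_graded qW' q(2)] by blast
      then have "60 \<le> gain (graded C) W' p"
        using gp[of "[p,q]" "[]"] lp q qW' True by simp
      then show ?thesis using g(1) unfolding W'_def by linarith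
    qed
  next
    case False
    have lw: "18 \<le> loss (graded C) W' p w" if "w \<in> W'" "w \<in> N p" for w
      using loss_white_18[OF W'V that deg'[OF that(1)]] .
    have ne: "N p \<inter> W' \<noteq> {}" using assms(7) W'_def by simp
    have pW: "p \<notin> W" using ne False Nu W' by auto
    show ?thesis
    proof (cases "2 \<le> card (N p \<inter> W')")
      case True
      then obtain T where "T \<subseteq> N p \<inter> W'" "card T = 2"
        using obtain_subset_with_card_n by metis
      then obtain a b where ab: "a \<in> N p" "a \<in> W'" "b \<in> N p" "b \<in> W'" "a \<noteq> b"
        by (auto simp: card_2_iff)
      have "12 \<le> loss (graded C) W' p p" using loss_center(3)[OF W'V False ne True] .
      then have "48 \<le> gain (graded C) W' p"
        using gp[of "[a,b]" "[p]"] lw[of a] lw[of b] ab False W'V assms(6) by auto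
      then show ?thesis using g(1) unfolding W'_def by linarith
    next
      case small: False
      obtain w where w: "w \<in> N p" "w \<in> W'" using ne by blast
      have Np: "N p \<inter> W' = {w}"
        by (rule sym, rule card_seteq) (use w small finite_Int_N[OF W'V] in auto)
      show ?thesis
      proof (cases "N w \<inter> W = {w}")
        case True
        then have "N w \<inter> W' \<subseteq> N p" using w W' by auto
        then have "loss (graded C) W' p w = 30"
          using loss_white_all[OF admissible_graded w(2,1)] by blast
        moreover have "8 \<le> loss (graded C) W' p p" using loss_center(1)[OF W'V False ne] .
        ultimately have "38 \<le> gain (graded C) W' p"
          using gp[of "[w]" "[p]"] w False W'V assms(6) by auto
        then show ?thesis using g(1) unfolding W'_def by linarith
      next
        case False
        \<comment> \<open>\<open>w\<close> and \<open>q\<close> form another white pair. The reply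
          is shown to be worth only 32 here, so Dominator's move has to account for 76.\<close>
        then obtain q where q: "q \<in> W" "q \<in> N w" "q \<noteq> w" using N_self w W' by blast
        have wW: "w \<in> W" using w W'W by blast
        obtain r where r: "r \<in> V" "r \<notin> W" "r \<notin> C" "N r \<inter> W = {w, q}"
          using gain_white_pair[OF wW q(1,2) q(3)[symmetric] assms(5)] by metis
        have wC: "w \<notin> C"
          using gain_white_pair_C[of w q] wW q assms(5) by fastforce
        have pC: "p \<notin> C" using cyclic_white_out[OF wW wC w(1)] .
        have Npw: "N p \<inter> W \<noteq> {w}"
          using white_pair_no_private[OF wW q(1,2) q(3)[symmetric] assms(5)] assms(6) pW by blast
        have uvp: "u \<in> N p \<or> v \<in> N p" using Npw Np W' by blast
        have "p \<noteq> t" using w t(4) W' by blast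
        \<comment> \<open>\<open>p\<close> sees \<open>w\<close> and at least one of
          \<open>u\<close>, \<open>v\<close>, but only \<open>w\<close> after Dominator's move, so
          its weight falls from 14 to 12.\<close>
        have "2 \<le> card (N p \<inter> W)"
        proof -
          obtain s where "s \<in> {u, v}" "{s, w} \<subseteq> N p \<inter> W" using uvp w wW assms(1,2) by blast
          moreover have "card {s, w} = 2" using w W' \<open>s \<in> {u, v}\<close> by auto
          ultimately show ?thesis using card_mono[OF finite_Int_N[OF W], of "{s,w}" p] by simp
        qed
        moreover have "N p \<inter> W - N u = {w}" using Np by (auto simp: W'_def)
        ultimately have "2 \<le> loss (graded C) W u p"
          using loss_blue[OF pW, of "graded C" u] pC by (auto simp: graded_def)
        then have D: "76 \<le> gain (graded C) W u" using g(2)[OF assms(6) pW \<open>p \<noteq> t\<close> uvp] by linarith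
        have qW': "q \<in> W'" using NW'[OF w(2)] q by blast
        have pr: "p \<noteq> r" using Np r(4) qW' q by blast
        have Nr: "N r \<inter> W' = {w, q}" using r(4) qW' w W' by blast
        \<comment> \<open>\<open>r\<close> completes a triangle on \<open>w\<close> and
          \<open>q\<close>; together with \<open>p\<close> and \<open>w\<close> the reply loses 2 +
          12 + 18.\<close>
        have "2 \<le> loss (graded C) W' p r"
          using loss_blue_hit(1)[OF W'V, of r p C] r W' Nr w q by auto
        moreover have "12 \<le> loss (graded C) W' p p"
          using loss_center(2)[OF W'V \<open>p \<notin> W'\<close> ne pC] .
        moreover have "18 \<le> loss (graded C) W' p w" using lw w by blast
        moreover have rW: "r \<notin> W'" using r(2) W' by blast
        ultimately have "32 \<le> gain (graded C) W' p"
          using gp[of "[w]" "[p,r]"] w(2) r(1) rW \<open>p \<notin> W'\<close> pr assms(6) by simp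
        then show ?thesis using D unfolding W'_def by linarith
      qed
    qed
  qed
qed

text \<open>If no move gains 78, then \<open>x\<close> sees exactly two white vertices, which lose
  30 each. For \<open>x\<close> in \<open>C\<close> there are 12 from \<open>x\<close>, 4 from the
  other cycle neighbour of \<open>u\<close> and 2 from a triangle on \<open>x\<close> and
  \<open>u\<close>. Otherwise \<open>x\<close> loses 14, and the triangles on \<open>x\<close> with
  \<open>u\<close> and with \<open>v\<close> bring 2 + 2, or at least 12 if they share their third
  vertex.\<close>

lemma gain_isolated_pair:
  assumes "\<And>v. v \<in> W \<Longrightarrow> N v \<inter> W = {v}" "x \<in> V" "2 \<le> card (N x \<inter> W)"
  shows "\<exists>x\<in>V. 78 \<le> gain (graded C) W x"
proof (rule ccontr)
  assume "\<not> ?thesis"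
  then have ng: "\<And>x. x \<in> V \<Longrightarrow> gain (graded C) W x < 78" by force
  have le2: "card (N y \<inter> W) \<le> 2" if "y \<in> V" for y
  proof (rule ccontr)
    assume c: "\<not> ?thesis"
    then have "N y \<inter> W \<noteq> {}" using c by force
    then obtain u where u: "u \<in> N y" "u \<in> W" by blast
    show False using gain_blue_triple[of y u] assms(1)[OF u(2)] u c that ng[OF that] by force
  qed
  have "card (N x \<inter> W) = 2" using le2 assms by force
  then obtain u v where uv: "N x \<inter> W = {u, v}" "u \<noteq> v" by (auto simp: card_2_iff)
  then have W': "u \<in> W" "v \<in> W" "u \<in> N x" "v \<in> N x" by auto
  then have V: "u \<in> V" "v \<in> V" using W by auto
  have xW: "x \<notin> W" using assms(1)[of x] uv by auto
  then have xuv: "x \<noteq> u" "x \<noteq> v" using W' by auto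
  have l: "loss (graded C) W x u = 30" "loss (graded C) W x v = 30"
    using loss_white_all[OF admissible_graded] W' assms(1) by auto
  have lx: "12 \<le> loss (graded C) W x x" using loss_center(3)[OF W xW _ assms(3)] uv by auto
  have hit: "2 \<le> loss (graded C) W x y" if "y \<in> V" "y \<notin> W" "w \<in> N y" "w \<in> W" "w \<in> N x" for y w
    using loss_blue_hit(1)[OF W that(2), of x C] le2 that by blast
  have xV: "x \<in> N u" "x \<in> N v" using W' N_sym by auto
  obtain y where y: "y \<in> V" "y \<in> N x" "y \<in> N u" "x \<in> N y" "u \<in> N y" "y \<noteq> x" "y \<noteq> u"
    using common_neighbour[OF V(1) xV(1) xuv(1)] by blast
  obtain z where z: "z \<in> V" "z \<in> N x" "z \<in> N v" "x \<in> N z" "v \<in> N z" "z \<noteq> x" "z \<noteq> v"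
    using common_neighbour[OF V(2) xV(2) xuv(2)] by blast
  have yzW: "y \<notin> W" "z \<notin> W" using assms(1) W' y z by blast+
  show False
  proof (cases "x \<in> C")
    case True
    then have uC: "u \<in> C" using cyclic_in W' by blast
    have yC: "y \<notin> C"
      using cyclic_no_triangle(1)[OF True uC, of y] xuv xV y by blast
    obtain a b where ab: "a \<noteq> u" "b \<noteq> u" "a \<noteq> b" "a \<in> C" "b \<in> C" "a \<in> N u" "b \<in> N u"
      using cyclic_neighbours[OF uC] by metis
    then obtain c where c: "c \<in> C" "c \<in> N u" "c \<noteq> u" "c \<noteq> x" by metis
    then have cW: "c \<notin> W" using assms(1)[OF W'(1)] by blast
    have cV: "c \<in> V" using c cyclic_subset by blast
    have uc: "u \<in> N c" using c N_sym by blast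
    have "4 \<le> loss (graded C) W x c"
      using loss_blue_hit(2)[OF W cW, of x C] uc W' c le2[OF cV] by blast
    moreover have "2 \<le> loss (graded C) W x y" using hit y yzW W' by blast
    moreover have "y \<noteq> c" using yC c by blast
    ultimately show False
      using gain_ge[OF admissible_graded W, of "[u,v]" "[x,y,c]" C x] l lx ng[OF assms(2)] assms(2)
        uv(2) xW y(1,6) yzW c(4) cW cV W'
      by simp
  next
    case False
    have lx: "14 \<le> loss (graded C) W x x" using loss_center(4)[OF W xW _ assms(3) False] uv by auto
    show False
    proof (cases "y = z")
      case True
      have "N y \<inter> W = {u, v}"
        by (rule sym, rule card_seteq)
          (use y z True W' uv le2[OF y(1)] finite_Int_N[OF W] in auto)
      then have "12 \<le> loss (graded C) W x y"
        using loss_blue_all[OF admissible_graded yzW(1), of x C] W' uv by (auto simp: graded_def)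
      then have "78 \<le> gain (graded C) W x"
        using gain_ge[OF admissible_graded W, of "[u,v]" "[x,y]" C x] l lx assms(2) xW uv(2) y(1,6) yzW W'
        by simp
      then show False using ng[OF assms(2)] by simp
    next
      case False
      have "2 \<le> loss (graded C) W x y" "2 \<le> loss (graded C) W x z" using hit y z yzW W' by blast+
      then have "78 \<le> gain (graded C) W x"
        using gain_ge[OF admissible_graded W, of "[u,v]" "[x,y,z]" C x] l lx assms(2) xW uv(2) y(1,6) z(1,6) False yzW W'
        by simp
      then show False using ng[OF assms(2)] by simp
    qed
  qed
qed

end

text \<open>Every neighbour of \<open>v\<close> sees no other white vertex and loses all its weight.
  Outside \<open>C\<close> two neighbours give 30 + 12 + 12 = 54, which is tight; inside
  \<open>C\<close> two cycle neighbours and the third vertex of a triangle give 30 + 8 + 8 +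
  12.\<close>

lemma gain_singletons:
  assumes "\<And>x. x \<in> V \<Longrightarrow> card (N x \<inter> W) \<le> 1" "p \<in> V" "v \<in> N p" "v \<in> W"
  shows "54 \<le> gain (graded C) W p"
proof -
  have N: "N x \<inter> W = {v}" if "x \<in> V" "v \<in> N x" for x
    by (rule sym, rule card_seteq) (use assms that finite_Int_N[OF W] in auto)
  have vV: "v \<in> V" using assms W by auto
  have lv: "loss (graded C) W p v = 30"
    using loss_white_all[OF admissible_graded assms(4,3)] N[OF vV N_self] assms by auto
  have b: "y \<in> V" "y \<notin> W" "loss (graded C) W p y = (if y \<in> C then 8 else 12)" if "y \<in> N v" "y \<noteq> v" for y
  proof -
    show yV: "y \<in> V" using N_subset[OF vV] that by blast
    show yW: "y \<notin> W" using N[OF vV N_self] that by blast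
    show "loss (graded C) W p y = (if y \<in> C then 8 else 12)"
      using loss_blue_all[OF admissible_graded yW, of p C] N[OF yV] that N_sym assms
      by (auto simp: graded_def)
  qed
  show ?thesis
  proof (cases "v \<in> C")
    case True
    obtain c d where cd: "c \<noteq> v" "d \<noteq> v" "c \<noteq> d" "c \<in> C" "d \<in> C" "c \<in> N v" "d \<in> N v"
      using cyclic_neighbours[OF True] by metis
    obtain t where t: "t \<in> N c" "t \<in> N v" "t \<noteq> c" "t \<noteq> v"
      using common_neighbour[OF vV cd(6,1)] by metis
    have tC: "t \<notin> C" using cyclic_no_triangle(1)[OF cd(4) True cd(1) cd(6)] t by blast
    show ?thesis
      using gain_ge[OF admissible_graded W, of "[v]" "[c,d,t]" C p] lv b[of c] b[of d] b[of t] cd t tC vV assms(4)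
      by fastforce
  next
    case False
    obtain y where y: "y \<in> N v" "y \<noteq> v" using not_isolated[OF vV] by blast
    obtain z where z: "z \<in> V" "z \<in> N y" "z \<in> N v" "y \<in> N z" "v \<in> N z" "z \<noteq> y" "z \<noteq> v"
      using common_neighbour[OF vV y] by blast
    have "v \<in> N y" using y N_sym by blast
    \<comment> \<open>Neighbours of a white vertex outside \<open>C\<close> lie outside
      \<open>C\<close> too, hence weigh 12 rather than 8.\<close>
    then have "y \<notin> C" "z \<notin> C" using cyclic_white_out[OF assms(4) False] z by blast+
    then show ?thesis
      using gain_ge[OF admissible_graded W, of "[v]" "[y,z]" C p] lv b[of y] b[of z] y z vV assms(4)
      by fastforce
  qed
qed

end

text \<open>The 108 arises as 78 + 30 if some move gains 78; otherwise from a white pair, as 74 + 34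
  or 76 + 32; and once every vertex sees at most one white vertex, as 54 + 54.\<close>

lemma cyclic_round:
  assumes "cyclic C W" "W \<subseteq> V" "W \<noteq> {}"
  shows "\<exists>v\<in>V. N v \<inter> W \<noteq> {} \<and> 54 \<le> gain (graded C) W v \<and>
    (\<forall>p\<in>V. N p \<inter> (W - N v) \<noteq> {} \<longrightarrow> 108 \<le> gain (graded C) W v + gain (graded C) (W - N v) p)"
proof (cases "\<exists>x\<in>V. 78 \<le> gain (graded C) W x")
  case True
  then obtain x where x: "x \<in> V" "78 \<le> gain (graded C) W x" by blast
  show ?thesis
  proof (rule round_of_gain[OF x(1) _ x(2), where b = 30])
    fix p assume "p \<in> V" "N p \<inter> (W - N x) \<noteq> {}"
    moreover have "cyclic C (W - N x)" using cyclic_mono[OF assms(2,1)] by blast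
    ultimately show "30 \<le> gain (graded C) (W - N x) p"
      using assms(2) by (intro gain_cyclic_ge) auto
  qed auto
next
  case False
  then have ng: "\<And>x. x \<in> V \<Longrightarrow> gain (graded C) W x < 78" by force
  have deg: "card (N v \<inter> W) \<le> 2" if v: "v \<in> W" for v
  proof (cases "v \<in> C")
    case True
    then have "card (N v \<inter> W) \<noteq> 3"
      using gain_cycle_vertex[OF assms(1,2) v] ng[of v] assms v by force
    moreover have "card (N v \<inter> W) \<le> 3" using cyclic_card3[OF assms(1,2)] v assms by blast
    ultimately show ?thesis by simp
  next
    case False
    then show ?thesis using cyclic_out[OF assms(1,2) v] by blast
  qed
  show ?thesis
  proof (cases "\<exists>u v. u \<in> W \<and> v \<in> W \<and> v \<in> N u \<and> u \<noteq> v")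
    case True
    then obtain u v where uv: "u \<in> W" "v \<in> W" "v \<in> N u" "u \<noteq> v" by blast
    have "74 \<le> gain (graded C) W u"
      using gain_white_pair[OF assms(1,2) deg uv ng] by metis
    then show ?thesis
      using white_pair_round[OF assms(1,2) deg uv ng] uv assms(2) N_self
      by (intro bexI[of _ u]) auto
  next
    case no: False
    then have iso: "N v \<inter> W = {v}" if "v \<in> W" for v using that N_self by blast
    have le1: "card (N x \<inter> W) \<le> 1" if "x \<in> V" for x
      using gain_isolated_pair[OF assms(1,2) deg iso that] False by force
    obtain v where v: "v \<in> W" using assms by blast
    have "54 \<le> gain (graded C) (W - N v) p" if p: "p \<in> V" "N p \<inter> (W - N v) \<noteq> {}" for p
    proof -
      obtain w where w: "w \<in> N p" "w \<in> W - N v" using p by blast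
      have "card (N x \<inter> (W - N v)) \<le> 1" if "x \<in> V" for x
        using le1[OF that] card_mono[OF finite_Int_N[OF assms(2)], of "N x \<inter> (W - N v)" x] by force
      then show ?thesis
        using gain_singletons[OF cyclic_mono[OF assms(2,1), of "W - N v"] _ _ p(1) w] assms(2) by blast
    qed
    moreover have v54: "54 \<le> gain (graded C) W v"
      using gain_singletons[OF assms(1,2) le1 _ N_self v] v assms(2) by blast
    moreover have "v \<in> V" using v assms(2) by blast
    ultimately show ?thesis by (intro round_of_gain[where x = v and a = 54 and b = 54]) auto
  qed
qed

text \<open>When no move gains 80, the two white neighbours of a vertex are not adjacent, by
  \<open>gain_white_triangle\<close>, and have two white neighbours themselves, by
  \<open>gain_path_end\<close>. So the vertices of white degree two are closed under white adjacency
  and form cycles without triangles.\<close>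

lemma cyclic_white_cycles:
  assumes "W \<subseteq> V" "\<forall>x\<in>V. card (N x \<inter> W) \<le> 3" "\<forall>x\<in>V. gain (graded {}) W x < 80"
  shows "cyclic {v \<in> W. card (N v \<inter> W) = 3} W"
proof -
  define C where "C = {v \<in> W. card (N v \<inter> W) = 3}"
  have *: "\<exists>a b. a \<noteq> v \<and> b \<noteq> v \<and> a \<noteq> b \<and> b \<notin> N a \<and> N v \<inter> W = {v, a, b} \<and> a \<in> C \<and> b \<in> C"
    if v: "v \<in> C" for v
  proof -
    have vW: "v \<in> W" "v \<in> V" using v assms(1) by (auto simp: C_def)
    have "card (N v \<inter> W - {v}) = 2" using v N_self by (simp add: C_def)
    then obtain a b where ab: "N v \<inter> W - {v} = {a, b}" "a \<noteq> b" by (auto simp: card_2_iff)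
    then have N: "N v \<inter> W = {v, a, b}" "a \<noteq> v" "b \<noteq> v" using N_self vW by blast+
    have abW: "a \<in> W" "b \<in> W" using N by auto
    have ng: "gain (graded {}) W v < 80" using assms vW by blast
    have nadj: "b \<notin> N a" using gain_white_triangle[OF assms(1,2) vW(1) N ab(2)] ng by linarith
    have nadj': "a \<notin> N b" using nadj N_sym by blast
    have "\<not> card (N a \<inter> W) \<le> 2" using gain_path_end[OF assms(1,2) vW(1) N ab(2) nadj] ng by linarith
    moreover have "N v \<inter> W = {v, b, a}" using N by auto
    then have "\<not> card (N b \<inter> W) \<le> 2"
      using gain_path_end[OF assms(1,2) vW(1) _ N(3,2) ab(2)[symmetric] nadj'] ng by linarith
    moreover have "card (N a \<inter> W) \<le> 3" "card (N b \<inter> W) \<le> 3" using assms(1,2) abW by blast+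
    ultimately have "a \<in> C" "b \<in> C" using abW by (auto simp: C_def)
    then show ?thesis using N ab(2) nadj by blast
  qed
  have "cyclic C W"
    unfolding cyclic_def
  proof (intro conjI ballI)
    fix v assume v: "v \<in> W - C"
    have "card (N v \<inter> W) \<le> 3" "card (N v \<inter> W) \<noteq> 3" using v assms(1,2) by (auto simp: C_def)
    then show "card (N v \<inter> W) \<le> 2" by linarith
    show "N v \<inter> W \<inter> C = {}"
    proof (rule ccontr)
      assume "\<not> ?thesis"
      then obtain c where c: "c \<in> C" "c \<in> N v" by blast
      have "v \<in> N c \<inter> W" using v c N_sym by blast
      moreover obtain a b where N: "N c \<inter> W = {c, a, b}" and ab: "a \<in> C" "b \<in> C"
        using *[OF c(1)] by metis
      ultimately have "v \<in> {c, a, b}" by (simp only: N)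
      then show False using v c(1) ab by blast
    qed
  next
    fix v assume "v \<in> C"
    then obtain a b where ab: "a \<noteq> v" "b \<noteq> v" "a \<noteq> b" "b \<notin> N a" "N v \<inter> W = {v, a, b}" "a \<in> C" "b \<in> C"
      using *[OF \<open>v \<in> C\<close>] by metis
    moreover have "C \<subseteq> W" by (auto simp: C_def)
    ultimately have "{v, a, b} \<subseteq> N v \<inter> C" "N v \<inter> C \<subseteq> {v, a, b}" using \<open>v \<in> C\<close> by auto
    then have "N v \<inter> C = {v, a, b}" by (rule equalityI[rotated])
    then show "\<exists>a b. a \<noteq> v \<and> b \<noteq> v \<and> a \<noteq> b \<and> b \<notin> N a \<and> N v \<inter> C = {v, a, b} \<and> N v \<inter> W \<subseteq> {v, a, b}"
      using ab by blast
  qed (use assms in \<open>auto simp: C_def\<close>)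
  then show ?thesis by (simp add: C_def)
qed

end

section \<open>The three phases combined\<close>

lemma game_triangle_graph:
  assumes "hypergraph V E" and "triangle_graph V (closed_nbhd E)"
  shows "54 * int (game_domination_number V E) \<le> 30 * int (card V)"
proof -
  interpret triangle_graph V "closed_nbhd E" by (rule assms(2))
  \<comment> \<open>The general strategy bound for potentials, with the differences rewritten as
    gains.\<close>
  have step: "moves_bounded V E W (potential g W)"
    if "admissible g" "P W" "\<And>W W'. P W \<Longrightarrow> W' \<subseteq> W \<Longrightarrow> P W'"
      and "\<And>W. W \<subseteq> V \<Longrightarrow> W \<noteq> {} \<Longrightarrow> P W \<Longrightarrow> moves_bounded V E W (potential g W) \<or>
        (\<exists>v\<in>V. closed_nbhd E v \<inter> W \<noteq> {} \<and> 54 \<le> gain g W v \<and>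
         (\<forall>p\<in>V. closed_nbhd E p \<inter> (W - closed_nbhd E v) \<noteq> {} \<longrightarrow>
            108 \<le> gain g W v + gain g (W - closed_nbhd E v) p))" for g P W
  proof (rule moves_bounded_strategy[where P = P])
    fix W assume "W \<subseteq> V" "W \<noteq> {}" "P W"
    moreover have "potential g W - potential g (W - closed_nbhd E v - closed_nbhd E p) =
        gain g W v + gain g (W - closed_nbhd E v) p" for v p
      by (simp add: gain_def)
    moreover have "potential g W - potential g (W - closed_nbhd E v) = gain g W v" for v
      by (simp add: gain_def)
    ultimately show "moves_bounded V E W (potential g W) \<or>
        (\<exists>v\<in>V. closed_nbhd E v \<inter> W \<noteq> {} \<and> 54 \<le> potential g W - potential g (W - closed_nbhd E v) \<and>
         (\<forall>p\<in>V. closed_nbhd E p \<inter> (W - closed_nbhd E v) \<noteq> {} \<longrightarrow>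
            108 \<le> potential g W - potential g (W - closed_nbhd E v - closed_nbhd E p)))"
      using that(4)[of W] by presburger
  qed (use that(1-3) assms(1) potential_nonneg in \<open>simp_all\<close>)
  have phase3: "moves_bounded V E W (potential (graded C) W)" if "cyclic C W" "W \<subseteq> V" for C W
  proof (rule step[where P = "\<lambda>W. cyclic C W \<and> W \<subseteq> V"])
    show "cyclic C W' \<and> W' \<subseteq> V" if "cyclic C W \<and> W \<subseteq> V" "W' \<subseteq> W" for W W'
      using that cyclic_mono[of W C W'] by blast
  next
    fix W assume "W \<subseteq> V" "W \<noteq> {}" "cyclic C W \<and> W \<subseteq> V"
    then show "moves_bounded V E W (potential (graded C) W) \<or>
        (\<exists>v\<in>V. closed_nbhd E v \<inter> W \<noteq> {} \<and> 54 \<le> gain (graded C) W v \<and>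
         (\<forall>p\<in>V. closed_nbhd E p \<inter> (W - closed_nbhd E v) \<noteq> {} \<longrightarrow>
            108 \<le> gain (graded C) W v + gain (graded C) (W - closed_nbhd E v) p))"
      using cyclic_round[of C W] by simp
  qed (simp_all add: that admissible_graded)
  have phase2: "moves_bounded V E W (potential (graded {}) W)"
    if "\<forall>x\<in>V. card (closed_nbhd E x \<inter> W) \<le> 3" "W \<subseteq> V" for W
  proof (rule step[where P = "\<lambda>W. (\<forall>x\<in>V. card (closed_nbhd E x \<inter> W) \<le> 3) \<and> W \<subseteq> V"])
    fix W assume W: "W \<subseteq> V" and c: "(\<forall>x\<in>V. card (closed_nbhd E x \<inter> W) \<le> 3) \<and> W \<subseteq> V"
    show "moves_bounded V E W (potential (graded {}) W) \<or>
        (\<exists>v\<in>V. closed_nbhd E v \<inter> W \<noteq> {} \<and> 54 \<le> gain (graded {}) W v \<and>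
         (\<forall>p\<in>V. closed_nbhd E p \<inter> (W - closed_nbhd E v) \<noteq> {} \<longrightarrow>
            108 \<le> gain (graded {}) W v + gain (graded {}) (W - closed_nbhd E v) p))"
    proof (cases "\<exists>x\<in>V. 80 \<le> gain (graded {}) W x")
      case True
      then obtain x where x: "x \<in> V" "80 \<le> gain (graded {}) W x" by blast
      show ?thesis
      proof (rule disjI2, rule round_of_gain[OF x(1) _ x(2), where b = 28])
        fix p assume "p \<in> V" "closed_nbhd E p \<inter> (W - closed_nbhd E x) \<noteq> {}"
        then show "28 \<le> gain (graded {}) (W - closed_nbhd E x) p"
          using W by (intro gain_graded_ge) auto
      qed auto
    next
      case False
      \<comment> \<open>The set of cycle vertices is fixed only now; the discount on it lowers the
        potential, so the bound of the last phase carries over.\<close>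
      have "potential (graded {v \<in> W. card (closed_nbhd E v \<inter> W) = 3}) W \<le> potential (graded {}) W"
        by (rule potential_mono) (auto simp: graded_def)
      moreover have "cyclic {v \<in> W. card (closed_nbhd E v \<inter> W) = 3} W"
        using cyclic_white_cycles[OF W] c False by (meson not_le)
      ultimately show ?thesis using phase3[OF _ W] moves_bounded_mono by blast
    qed
  next
    fix W W' assume c: "(\<forall>x\<in>V. card (closed_nbhd E x \<inter> W) \<le> 3) \<and> W \<subseteq> V" and s: "W' \<subseteq> W"
    have "card (closed_nbhd E x \<inter> W') \<le> card (closed_nbhd E x \<inter> W)" for x
      using c s by (intro card_mono finite_Int_N) auto
    then show "(\<forall>x\<in>V. card (closed_nbhd E x \<inter> W') \<le> 3) \<and> W' \<subseteq> V"
      using c s by (meson order_trans)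
  qed (use that admissible_graded in auto)
  have phase1: "moves_bounded V E W (potential flat W)" if "W \<subseteq> V" for W
  proof (rule step[where P = "\<lambda>W. W \<subseteq> V"])
    fix W assume W: "W \<subseteq> V"
    show "moves_bounded V E W (potential flat W) \<or>
        (\<exists>v\<in>V. closed_nbhd E v \<inter> W \<noteq> {} \<and> 54 \<le> gain flat W v \<and>
         (\<forall>p\<in>V. closed_nbhd E p \<inter> (W - closed_nbhd E v) \<noteq> {} \<longrightarrow>
            108 \<le> gain flat W v + gain flat (W - closed_nbhd E v) p))"
    proof (cases "\<exists>x\<in>V. 4 \<le> card (closed_nbhd E x \<inter> W)")
      case True
      then obtain x where x: "x \<in> V" "4 \<le> card (closed_nbhd E x \<inter> W)" by blast
      show ?thesis
      proof (rule disjI2, rule round_of_gain[OF x(1) _ gain_flat_large[OF W x], where b = 30])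
        fix p assume "p \<in> V" "closed_nbhd E p \<inter> (W - closed_nbhd E x) \<noteq> {}"
        then show "30 \<le> gain flat (W - closed_nbhd E x) p"
          using W by (intro gain_flat_ge) auto
      qed auto
    next
      case False
      have "potential (graded {}) W \<le> potential flat W"
        by (rule potential_mono) (auto simp: graded_def flat_def)
      moreover have "\<forall>x\<in>V. card (closed_nbhd E x \<inter> W) \<le> 3" using False by fastforce
      ultimately show ?thesis using phase2[OF _ W] moves_bounded_mono by blast
    qed
  qed (use that admissible_flat in auto)
  \<comment> \<open>At the start all vertices are white, so the potential is 30 times their
    number.\<close>
  have "54 * int (game_val (card V) V E True {}) \<le> potential flat V"
    using phase1[of V] by (auto simp: moves_bounded_def closed_nbhd_set_def)
  then show ?thesis
    by (simp add: game_domination_number_def potential_def weight_def)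
qed

theorem theorem5:
  fixes V :: "'a set" and E :: "'a set set"
  assumes "hypergraph V E"
    and "\<forall>v\<in>V. \<not> isolated E v"
    and "\<forall>e\<in>E. finite e \<and> card e \<ge> 3"
  shows "real (game_domination_number V E) \<le> 5 / 9 * real (card V)"
proof -
  have fin: "finite V" using assms(1) by (simp add: hypergraph_def)
  have "triangle_graph V (closed_nbhd E)"
  proof
    fix u v assume uv: "u \<in> closed_nbhd E v" "u \<noteq> v"
    then obtain e where e: "e \<in> E" "u \<in> e" "v \<in> e" by (auto simp: closed_nbhd_def adjacent_def)
    \<comment> \<open>The size condition on edges supplies the third vertex of the triangle.\<close>
    have "\<not> e \<subseteq> {u, v}"
    proof
      assume "e \<subseteq> {u, v}"
      then have "card e \<le> card {u, v}" by (intro card_mono) auto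
      also have "\<dots> = 2" using uv(2) by simp
      finally show False using assms(3) e(1) by fastforce
    qed
    then obtain w where "w \<in> e" "w \<noteq> u" "w \<noteq> v" by blast
    moreover from this have "adjacent E u w" "adjacent E v w" using e unfolding adjacent_def by blast+
    ultimately show "\<exists>w. w \<in> closed_nbhd E u \<and> w \<in> closed_nbhd E v \<and> w \<noteq> u \<and> w \<noteq> v"
      unfolding closed_nbhd_def by blast
  next
    fix v assume "v \<in> V"
    then obtain u where "adjacent E v u" using assms(2) by (auto simp: isolated_def)
    then show "\<exists>u\<in>closed_nbhd E v. u \<noteq> v" by (auto simp: closed_nbhd_def adjacent_def)
  next
    show "closed_nbhd E v \<subseteq> V" if "v \<in> V" for v by (rule closed_nbhd_subset[OF assms(1) that])
    show "v \<in> closed_nbhd E v" for v by (simp add: closed_nbhd_def)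
    show "v \<in> closed_nbhd E u" if "u \<in> closed_nbhd E v" for u v
      using that by (auto simp: closed_nbhd_def adjacent_def)
  qed (rule fin)
  from game_triangle_graph[OF assms(1) this]
  have "54 * real (game_domination_number V E) \<le> 30 * real (card V)" by linarith
  then show ?thesis by simp
qed

end
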